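(* Let $T$ and $k$ be positive integers and let $w=\lceil T/k\rceil$. Consider a time-bucketed balance record structure $\mathcal{B}$ (as defined in the context) with these parameters, initially empty, and let an arbitrary finite sequence of operations (Deposit, Consume, Transfer, Prune, in any order, with arbitrary positive amounts, and where $\mathcal{B}$ may play the role of either sender or recipient in transfers) be applied to it at nondecreasing integer times. Then at all times the number of records satisfies $|\mathcal{B}|\le k+1$.
   Context: Times are nonnegative integers (seconds). A balance record structure is a finite list $\mathcal{B}=[(a_1,e_1),\dots,(a_n,e_n)]$ of pairs (amount $a_i\ge 0$, expiration timestamp $e_i$), kept sorted with $e_1<e_2<\dots<e_n$; $|\mathcal{B}|=n$ is the number of records. Fix a TTL $T$ and bucket width $w=\lceil T/k\rceil$, and define $\mathrm{BucketedExpiry}(t)=\lceil (t+T)/w\rceil\cdot w$. All structures in the system use the same $T$ and $w$. The operations, performed at current time $t_{\mathrm{now}}$, are: - Prune$(\mathcal{B},t_{\mathrm{now}})$: delete every record with $e_i\le t_{\mathrm{now}}$ or $a_i=0$, keeping the order of the remaining ones. - Insert$(\mathcal{B},a,e,t_{\mathrm{now}})$: first run Prune$(\mathcal{B},t_{\mathrm{now}})$; then scan records in order: if a record with $e_i=e$ is found, set $a_i\leftarrow a_i+a$ and stop (coalescing); if a record with $e_i>e$ is found first, insert $(a,e)$ immediately before it (shifting later records) and stop; if neither occurs, append $(a,e)$ at the end. - Deposit of amount $a>0$ at time $t$: Insert$(\mathcal{B},a,\mathrm{BucketedExpiry}(t),t)$. - Consume$(\mathcal{B},a,t_{\mathrm{now}})$: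 with remaining $r=a$ and an empty list $C$, scan records in order, skipping those with $e_i\le t_{\mathrm{now}}$; for each other record put $\delta=\min(r,a_i)$, set $a_i\leftarrow a_i-\delta$, append $(\delta,e_i)$ to $C$, and $r\leftarrow r-\delta$; if $r=0$ return success and $C$. If the scan ends with $r>0$, return failure. - Transfer of amount $a$ from $\mathcal{B}_s$ to $\mathcal{B}_r$ at time $t_{\mathrm{now}}$: run Consume$(\mathcal{B}_s,a,t_{\mathrm{now}})$; if it fails, stop; otherwise for each $(a_i,e_i)\in C$ run Insert$(\mathcal{B}_r,a_i,e_i,t_{\mathrm{now}})$ (the original expiration $e_i$ is kept, not re-bucketed). *)

theory Defs
  imports Complex_Main
begin

text \<open>A record is a pair (amount, expiration timestamp). Amounts live in an arbitrary
  \<open>linordered_semidom\<close>, so that natural, integer, rational and real amounts are all covered.\<close>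

type_synonym 'a records = "('a \<times> nat) list"

definition bucket_width :: "nat \<Rightarrow> nat \<Rightarrow> nat" where
  "bucket_width T k = nat \<lceil>real T / real k\<rceil>"

definition bucketed_expiry :: "nat \<Rightarrow> nat \<Rightarrow> nat \<Rightarrow> nat" where
  "bucketed_expiry T w t = nat \<lceil>real (t + T) / real w\<rceil> * w"

definition prune :: "'a::linordered_semidom records \<Rightarrow> nat \<Rightarrow> 'a records" where
  "prune B now = filter (\<lambda>(a, e). \<not> (e \<le> now \<or> a = 0)) B"

fun insert_scan :: "'a::linordered_semidom \<Rightarrow> nat \<Rightarrow> 'a records \<Rightarrow> 'a records" where
  "insert_scan a e [] = [(a, e)]"
| "insert_scan a e ((a', e') # B) =
     (if e' = e then (a' + a, e') # B
      else if e' > e then (a, e) # (a', e') # B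
      else (a', e') # insert_scan a e B)"

definition insert_record ::
  "'a::linordered_semidom records \<Rightarrow> 'a \<Rightarrow> nat \<Rightarrow> nat \<Rightarrow> 'a records" where
  "insert_record B a e now = insert_scan a e (prune B now)"

definition deposit ::
  "nat \<Rightarrow> nat \<Rightarrow> 'a::linordered_semidom records \<Rightarrow> 'a \<Rightarrow> nat \<Rightarrow> 'a records" where
  "deposit T w B a t = insert_record B a (bucketed_expiry T w t) t"

text \<open>\<open>consume B r now\<close> returns the updated records together with \<open>Some C\<close> on success and
  \<open>None\<close> on failure. The updates are made in place during the scan, so they persist when the
  scan fails. For \<open>r > 0\<close> the end of the list is only reached with a positive remainder.\<close>

fun consume ::
  "'a::linordered_semidom records \<Rightarrow> 'a \<Rightarrow> nat \<Rightarrow> 'a records \<times> 'a records option" where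
  "consume [] r now = ([], None)"
| "consume ((a, e) # B) r now =
     (if e \<le> now then
        (case consume B r now of (B', res) \<Rightarrow> ((a, e) # B', res))
      else
        (let \<delta> = min r a in
         if r - \<delta> = 0 then ((a - \<delta>, e) # B, Some [(\<delta>, e)])
         else (case consume B (r - \<delta>) now of
                 (B', res) \<Rightarrow> ((a - \<delta>, e) # B', map_option (\<lambda>C. (\<delta>, e) # C) res))))"

datatype ('i, 'a) operation =
    Deposit 'i 'a
  | Consume 'i 'a
  | Transfer (sender: 'i) (recipient: 'i) 'a
  | Prune 'i

fun positive_amount :: "('i, 'a::linordered_semidom) operation \<Rightarrow> bool" where
  "positive_amount (Deposit i a) \<longleftrightarrow> a > 0"
| "positive_amount (Consume i a) \<longleftrightarrow> a > 0"
| "positive_amount (Transfer s r a) \<longleftrightarrow> a > 0"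
| "positive_amount (Prune i) \<longleftrightarrow> True"

text \<open>A system state assigns to every index \<open>i\<close> the structure it holds; a structure can only
  receive transfers from structures of the same system.\<close>

fun exec ::
  "nat \<Rightarrow> nat \<Rightarrow> nat \<Rightarrow> ('i, 'a::linordered_semidom) operation
    \<Rightarrow> ('i \<Rightarrow> 'a records) \<Rightarrow> ('i \<Rightarrow> 'a records)" where
  "exec T w t (Deposit i a) S = S(i := deposit T w (S i) a t)"
| "exec T w t (Consume i a) S = S(i := fst (consume (S i) a t))"
| "exec T w t (Transfer s r a) S =
     (case consume (S s) a t of
        (B', None) \<Rightarrow> S(s := B')
      | (B', Some C) \<Rightarrow>
          (let S' = S(s := B')
           in S'(r := fold (\<lambda>(c, e) B. insert_record B c e t) C (S' r))))"
| "exec T w t (Prune i) S = S(i := prune (S i) t)"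

definition run ::
  "nat \<Rightarrow> nat \<Rightarrow> (nat \<times> ('i, 'a::linordered_semidom) operation) list \<Rightarrow> ('i \<Rightarrow> 'a records)" where
  "run T w ops = fold (\<lambda>(t, p) S. exec T w t p S) ops (\<lambda>_. [])"

end

theory Submission
  imports Defs
begin

text \<open>Every insertion at time \<open>t\<close> prunes first, so right after it all expirations are multiples
  of \<open>w\<close> in the window from \<open>t\<close> (exclusive) to the bucketed expiry of \<open>t\<close> (inclusive); for a
  transfer this uses that the consumed records are unexpired and that bucketed expiry is monotone
  in time. Other operations add no expirations, so each structure always fits the window of its
  last insertion, although that window may lie in the past and the records may have expired since.
  As \<open>T \<le> k * w\<close>, a window contains at most \<open>k + 1\<close> multiples of \<open>w\<close>.\<close>

definition expiry_window :: "nat \<Rightarrow> nat \<Rightarrow> nat \<Rightarrow> nat set" where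
  "expiry_window T w t = {e. w dvd e \<and> t < e \<and> e \<le> bucketed_expiry T w t}"

text \<open>Strict order makes expirations distinct, so that the window bounds the length. The
  anchor \<open>t\<close> is existential because the passing of time deletes nothing.\<close>

definition well_bucketed :: "nat \<Rightarrow> nat \<Rightarrow> nat \<Rightarrow> 'a records \<Rightarrow> bool" where
  "well_bucketed T w now B \<longleftrightarrow>
     sorted_wrt (<) (map snd B) \<and> (\<exists>t\<le>now. snd ` set B \<subseteq> expiry_window T w t)"

lemma bucket_width_pos:
  assumes "T > 0" "k > 0"
  shows "bucket_width T k > 0"
  using assms by (simp add: bucket_width_def)

lemma le_mult_bucket_width:
  assumes "k > 0"
  shows "T \<le> k * bucket_width T k"
proof -
  have "real T / real k \<le> real (bucket_width T k)"
    unfolding bucket_width_def by linarith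
  then have "real T \<le> real (k * bucket_width T k)"
    using assms by (simp add: field_simps)
  then show ?thesis
    by (simp only: of_nat_le_iff)
qed

lemma bucketed_expiry_mono:
  assumes "t \<le> t'"
  shows "bucketed_expiry T w t \<le> bucketed_expiry T w t'"
  unfolding bucketed_expiry_def using assms
  by (intro mult_right_mono nat_mono ceiling_mono divide_right_mono) auto

lemma le_bucketed_expiry:
  assumes "w > 0"
  shows "t + T \<le> bucketed_expiry T w t"
proof -
  have "real (t + T) / real w \<le> real (nat \<lceil>real (t + T) / real w\<rceil>)"
    by linarith
  then have "real (t + T) \<le> real (bucketed_expiry T w t)"
    using assms unfolding bucketed_expiry_def of_nat_mult by (subst (asm) pos_divide_le_eq) auto
  then show ?thesis
    by (simp only: of_nat_le_iff)
qed

lemma bucketed_expiry_le: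
  assumes "t + T \<le> m * w"
  shows "bucketed_expiry T w t \<le> m * w"
proof (cases "w = 0")
  case False
  have "real (t + T) \<le> real m * real w"
    using assms by (metis of_nat_le_iff of_nat_mult)
  then have "real (t + T) / real w \<le> real m"
    using False by (simp add: divide_le_eq)
  then have "nat \<lceil>real (t + T) / real w\<rceil> \<le> m"
    by (simp add: ceiling_le_iff nat_le_iff)
  then show ?thesis
    by (simp add: bucketed_expiry_def)
qed (simp add: bucketed_expiry_def)

lemma bucketed_expiry_in_window:
  assumes "T > 0" "w > 0"
  shows "bucketed_expiry T w t \<in> expiry_window T w t"
  using le_bucketed_expiry[OF assms(2), of t T] assms(1)
  by (auto simp: expiry_window_def bucketed_expiry_def)

text \<open>The upper end only moves forward in time, so an expiration leaves the window only by
  expiring.\<close>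

lemma expiry_window_mono:
  assumes "e \<in> expiry_window T w t0" "t0 \<le> t" "t < e"
  shows "e \<in> expiry_window T w t"
  using assms bucketed_expiry_mono[of t0 t T w] by (auto simp: expiry_window_def)

lemma card_expiry_window_le:
  assumes "w > 0" "T \<le> k * w"
  shows "card (expiry_window T w t) \<le> k + 1"
proof -
  let ?q = "t div w"
  \<comment> \<open>The time \<open>t\<close> lies before the end \<open>(?q + 1) * w\<close> of its
    bucket, and \<open>T\<close> spans at most \<open>k\<close> further buckets.\<close>
  have "t + T \<le> (?q + k + 1) * w"
    using assms(2) dividend_less_div_times[OF assms(1), of t] by (simp add: algebra_simps)
  then have upper: "bucketed_expiry T w t \<le> (?q + k + 1) * w"
    by (rule bucketed_expiry_le)
  have "expiry_window T w t \<subseteq> (\<lambda>j. j * w) ` {?q<..?q + k + 1}"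
  proof
    fix e assume e: "e \<in> expiry_window T w t"
    then obtain j where j: "e = j * w"
      by (auto simp: expiry_window_def dvd_def mult.commute)
    have "j * w \<le> (?q + k + 1) * w" "t < j * w"
      using e j upper by (auto simp: expiry_window_def)
    \<comment> \<open>The strict bound \<open>t < j * w\<close> excludes \<open>j = ?q\<close>,
      which leaves \<open>k + 1\<close> values instead of \<open>k + 2\<close>.\<close>
    then have "j \<le> ?q + k + 1" "?q < j"
      using assms(1) by (simp_all only: mult_le_cancel2 div_less_iff_less_mult)
    then have "j \<in> {?q<..?q + k + 1}"
      by simp
    then show "e \<in> (\<lambda>j. j * w) ` {?q<..?q + k + 1}"
      using j by blast
  qed
  then have "card (expiry_window T w t) \<le> card {?q<..?q + k + 1}"
    by (meson card_image_le card_mono finite_greaterThanAtMost finite_imageI le_trans)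
  then show ?thesis
    by simp
qed

lemma well_bucketed_length_le:
  assumes "well_bucketed T w now B" "w > 0" "T \<le> k * w"
  shows "length B \<le> k + 1"
proof -
  obtain t where "snd ` set B \<subseteq> expiry_window T w t" and "distinct (map snd B)"
    using assms(1) by (auto simp: well_bucketed_def strict_sorted_iff)
  moreover have "finite (expiry_window T w t)"
    by (rule finite_subset[of _ "{..bucketed_expiry T w t}"]) (auto simp: expiry_window_def)
  ultimately have "card (set (map snd B)) \<le> card (expiry_window T w t)"
    by (simp add: card_mono)
  with \<open>distinct (map snd B)\<close> card_expiry_window_le[OF assms(2,3), of t] show ?thesis
    by (simp add: distinct_card del: set_map)
qed

lemma well_bucketed_mono:
  "well_bucketed T w t B \<Longrightarrow> t \<le> t' \<Longrightarrow> well_bucketed T w t' B"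
  by (meson le_trans well_bucketed_def)

lemma snd_set_insert_scan: "snd ` set (insert_scan a e B) = insert e (snd ` set B)"
  by (induction a e B rule: insert_scan.induct) auto

lemma strict_sorted_insert_scan:
  "sorted_wrt (<) (map snd B) \<Longrightarrow> sorted_wrt (<) (map snd (insert_scan a e B))"
proof (induction a e B rule: insert_scan.induct)
  case (2 a e a' e' B)
  then show ?case
    using snd_set_insert_scan[of a e B] by auto
qed simp

lemma well_bucketed_prune:
  assumes "well_bucketed T w now B"
  shows "well_bucketed T w now (prune B t)"
proof -
  have "snd ` set (prune B t) \<subseteq> snd ` set B"
    by (auto simp: prune_def)
  moreover have "sorted_wrt (<) (map snd (prune B t))"
    using assms by (simp add: well_bucketed_def prune_def sorted_wrt_map sorted_wrt_filter)
  ultimately show ?thesis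
    using assms unfolding well_bucketed_def by (meson subset_trans)
qed

lemma well_bucketed_insert_record:
  assumes "well_bucketed T w t B" "e \<in> expiry_window T w t"
  shows "well_bucketed T w t (insert_record B a e t)"
proof -
  obtain t0 where t0: "t0 \<le> t" "snd ` set B \<subseteq> expiry_window T w t0"
    using assms(1) by (auto simp: well_bucketed_def)
  \<comment> \<open>Pruning leaves only expirations after \<open>t\<close>, so the anchor can move
    from \<open>t0\<close> to \<open>t\<close>, whose window also contains the new
    \<open>e\<close>.\<close>
  have "snd ` set (prune B t) \<subseteq> expiry_window T w t"
    using t0 by (auto simp: prune_def intro!: expiry_window_mono[of _ T w t0 t])
  moreover have "sorted_wrt (<) (map snd (prune B t))"
    using well_bucketed_prune[OF assms(1)] by (simp add: well_bucketed_def)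
  ultimately show ?thesis
    using assms(2) unfolding well_bucketed_def insert_record_def
    by (auto simp: snd_set_insert_scan intro: strict_sorted_insert_scan)
qed

lemma well_bucketed_fold_insert_record:
  assumes "well_bucketed T w t B" "snd ` set C \<subseteq> expiry_window T w t"
  shows "well_bucketed T w t (fold (\<lambda>(c, e) B. insert_record B c e t) C B)"
  using assms by (induction C arbitrary: B) (auto simp: well_bucketed_insert_record)

text \<open>Consumption only lowers amounts: emptied records stay in place until a prune, and a
  failed scan changes no expiration either.\<close>

lemma map_snd_consume: "map snd (fst (consume B r now)) = map snd B"
  by (induction B r now rule: consume.induct) (auto simp: Let_def split: prod.splits)

lemma snd_set_consumed:
  "snd (consume B r now) = Some C \<Longrightarrow> snd ` set C \<subseteq> {e \<in> snd ` set B. now < e}"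
proof (induction B r now arbitrary: C rule: consume.induct)
  case (2 a e B r now)
  show ?case
  proof (cases "e \<le> now")
    case True
    then show ?thesis
      using 2(1)[OF True, of C] 2(3) by (auto split: prod.splits)
  next
    case False
    show ?thesis
    proof (cases "r - min r a = 0")
      case True
      then show ?thesis
        using False 2(3) by (auto simp: Let_def)
    next
      case nz: False
      then obtain D where "snd (consume B (r - min r a) now) = Some D" "C = (min r a, e) # D"
        using False 2(3) by (auto simp: Let_def split: prod.splits)
      then show ?thesis
        using 2(2)[OF False refl nz, of D] False by auto
    qed
  qed
qed simp

lemma well_bucketed_consume:
  assumes "well_bucketed T w now B"
  shows "well_bucketed T w now (fst (consume B r t))"
  using assms map_snd_consume[of B r t] unfolding well_bucketed_def by (metis set_map)

text \<open>The scan skips expired records, so what it takes from the window of the sender at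
  \<open>t0\<close> also lies in the window at \<open>t\<close>. The latter depends only on
  \<open>T\<close>, \<open>w\<close> and \<open>t\<close>, hence serves any recipient.\<close>

lemma consumed_in_window:
  assumes "well_bucketed T w t B" "snd (consume B r t) = Some C"
  shows "snd ` set C \<subseteq> expiry_window T w t"
proof -
  obtain t0 where "t0 \<le> t" "snd ` set B \<subseteq> expiry_window T w t0"
    using assms(1) by (auto simp: well_bucketed_def)
  then show ?thesis
    using snd_set_consumed[OF assms(2)] expiry_window_mono[of _ T w t0 t] by blast
qed

lemma well_bucketed_exec:
  assumes "T > 0" "w > 0" "\<And>j. well_bucketed T w t (S j)"
  shows "well_bucketed T w t (exec T w t p S j)"
proof (cases p)
  case (Deposit i a)
  then show ?thesis
    using assms
    by (simp add: deposit_def well_bucketed_insert_record bucketed_expiry_in_window)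
next
  case (Consume i a)
  then show ?thesis
    using assms by (simp add: well_bucketed_consume)
next
  case (Transfer s r a)
  obtain B' res where c: "consume (S s) a t = (B', res)"
    by fastforce
  have B': "well_bucketed T w t B'"
    using well_bucketed_consume[OF assms(3)[of s], of a t] c by simp
  show ?thesis
  proof (cases res)
    case None
    then show ?thesis
      using Transfer c B' assms(3) by simp
  next
    case (Some C)
    then have "snd ` set C \<subseteq> expiry_window T w t"
      using consumed_in_window[OF assms(3)[of s], of a C] c by simp
    then show ?thesis
      \<comment> \<open>The insertions start from \<open>B'\<close> if sender and recipient
        coincide, and from \<open>S r\<close> otherwise; both are well bucketed.\<close>
      using Transfer c Some B' assms(3) by (simp add: Let_def well_bucketed_fold_insert_record)
  qed
next
  case (Prune i)
  then show ?thesis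
    using assms by (simp add: well_bucketed_prune)
qed

lemma well_bucketed_run:
  assumes "T > 0" "w > 0" "sorted (map fst ops)" "\<forall>x\<in>set ops. fst x \<le> now"
  shows "well_bucketed T w now (run T w ops i)"
  using assms(3,4)
proof (induction ops arbitrary: now i rule: rev_induct)
  case Nil
  then show ?case
    by (auto simp: well_bucketed_def run_def)
next
  case (snoc x ops)
  obtain t p where x: "x = (t, p)"
    by fastforce
  \<comment> \<open>By sortedness the last time \<open>t\<close> bounds all earlier ones and can
    replace \<open>now\<close>. Every \<open>j\<close> is needed because a transfer involves a
    second structure.\<close>
  have "well_bucketed T w t (run T w ops j)" for j
    using snoc.prems(1) x by (intro snoc.IH) (auto simp: sorted_append)
  then have "well_bucketed T w t (exec T w t p (run T w ops) i)"
    by (rule well_bucketed_exec[OF assms(1,2)])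
  then show ?case
    using snoc.prems(2) x by (auto simp: run_def intro: well_bucketed_mono)
qed

theorem theorem1:
  fixes T k w :: nat
    and ops :: "(nat \<times> ('i, 'a::linordered_semidom) operation) list"
    and i :: 'i
  assumes "T > 0" and "k > 0" and "w = bucket_width T k"
    and "sorted (map fst ops)"
    and "\<forall>(t, p) \<in> set ops. positive_amount p"
  shows "\<forall>n \<le> length ops. length (run T w (take n ops) i) \<le> k + 1"
proof (intro allI impI)
  fix n
  have w: "w > 0" "T \<le> k * w"
    using assms(1-3) bucket_width_pos le_mult_bucket_width by auto
  \<comment> \<open>For \<open>n = 0\<close> the maximum is unspecified, but it only has to bound
    the times of an empty list.\<close>
  have "well_bucketed T w (Max (fst ` set (take n ops))) (run T w (take n ops) i)"
    using assms(1,4) w(1) by (intro well_bucketed_run) (auto simp: take_map[symmetric])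
  then show "length (run T w (take n ops) i) \<le> k + 1"
    using w by (rule well_bucketed_length_le)
qed

end
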